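(* Let $\alpha\in(0,1)$ and $\mu,\lambda_1,\beta_1>0$, and let $M_{\alpha,\beta_1,\lambda_1,\mu}(t)$, $t\ge 0$, be the tempered Mittag-Leffler Lévy process. Then for every real $q>0$, $$\mathbb{E}\left[(M_{\alpha,\beta_1,\lambda_1,\mu}(t))^q\right]\sim\left(\frac{\alpha\beta_1\mu^{\alpha-1}}{\lambda_1}\right)^q t^q\qquad\text{as } t\to\infty,$$ where $a(t)\sim b(t)$ means $a(t)/b(t)\to1$.
   Context: The tempered Mittag-Leffler Lévy process (TMLLP) is $M_{\alpha,\beta_1,\lambda_1,\mu}(t):=S_{\alpha,\mu}(G_{\lambda_1,\beta_1}(t))$, where $S_{\alpha,\mu}$ and $G_{\lambda_1,\beta_1}$ are independent; $G_{\lambda_1,\beta_1}(t)$ is the gamma subordinator with density $\frac{\lambda_1^{\beta_1 t}}{\Gamma(\beta_1 t)}x^{\beta_1 t-1}e^{-\lambda_1 x}$, $x>0$; and $S_{\alpha,\mu}(t)$ is the tempered $\alpha$-stable subordinator with density $e^{-\mu x+\mu^\alpha t}g_\alpha(x,t)$, $x>0$, where $g_\alpha(\cdot,t)$ is the density of the $\alpha$-stable subordinator with Laplace transform $e^{-tu^\alpha}$. The Laplace transform of the TMLLP is $\mathbb{E}[e^{-uM_{\alpha,\beta_1,\lambda_1,\mu}(t)}]=\left(\frac{\lambda_1}{\lambda_1-\mu^\alpha+(\mu+u)^\alpha}\right)^{\beta_1 t}$, $u\ge0$. *)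

theory Defs
  imports "HOL-Probability.Probability" "HOL-Library.Landau_Symbols"
begin

text \<open>
  Continuous-time processes have type \<open>real \<Rightarrow> 'a \<Rightarrow> real\<close>; only their values at times \<open>t \<ge> 0\<close>
  are constrained.  Path properties are required for every outcome, not just almost surely, so
  that subordinating one process by another yields a random variable even if the
  underlying probability space is not complete.
\<close>

definition cadlag_path :: "(real \<Rightarrow> real) \<Rightarrow> bool" where
  "cadlag_path f \<longleftrightarrow>
     (\<forall>t\<ge>0. continuous (at_right t) f) \<and> (\<forall>t>0. \<exists>l. (f \<longlongrightarrow> l) (at_left t))"

context prob_space
begin

definition independent_increments :: "(real \<Rightarrow> 'a \<Rightarrow> real) \<Rightarrow> bool" where
  "independent_increments X \<longleftrightarrow>
     (\<forall>(n::nat) t. 0 \<le> t 0 \<and> (\<forall>i<n. t i < t (Suc i)) \<longrightarrow>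
        indep_vars (\<lambda>_. borel) (\<lambda>i \<omega>. X (t (Suc i)) \<omega> - X (t i) \<omega>) {..<n})"

definition stationary_increments :: "(real \<Rightarrow> 'a \<Rightarrow> real) \<Rightarrow> bool" where
  "stationary_increments X \<longleftrightarrow>
     (\<forall>s\<ge>0. \<forall>h\<ge>0. distr M borel (\<lambda>\<omega>. X (s + h) \<omega> - X s \<omega>) = distr M borel (X h))"

definition levy_process :: "(real \<Rightarrow> 'a \<Rightarrow> real) \<Rightarrow> bool" where
  "levy_process X \<longleftrightarrow>
     (\<forall>t\<ge>0. random_variable borel (X t)) \<and>
     (AE \<omega> in M. X 0 \<omega> = 0) \<and>
     independent_increments X \<and>
     stationary_increments X \<and>
     (\<forall>\<omega>\<in>space M. cadlag_path (\<lambda>t. X t \<omega>))"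

definition subordinator :: "(real \<Rightarrow> 'a \<Rightarrow> real) \<Rightarrow> bool" where
  "subordinator X \<longleftrightarrow>
     levy_process X \<and>
     (\<forall>\<omega>\<in>space M. (\<forall>t\<ge>0. 0 \<le> X t \<omega>) \<and> mono_on {0..} (\<lambda>t. X t \<omega>))"

definition gamma_subordinator :: "real \<Rightarrow> real \<Rightarrow> (real \<Rightarrow> 'a \<Rightarrow> real) \<Rightarrow> bool" where
  "gamma_subordinator lambda \<beta> G \<longleftrightarrow>
     subordinator G \<and>
     (\<forall>t>0. distributed M lborel (G t)
        (\<lambda>x. ennreal (indicator {0<..} x *
               (lambda powr (\<beta> * t) / Gamma (\<beta> * t) * x powr (\<beta> * t - 1) * exp (- lambda * x)))))"

end

text \<open>
  \<open>g x t\<close> is, as a function of \<open>x > 0\<close>, a density of the \<open>\<alpha>\<close>-stable subordinator at time \<open>t\<close>.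
  Its law is specified by the Laplace transform \<open>exp (- t u\<^sup>\<alpha>)\<close>, \<open>u \<ge> 0\<close>, which
  determines \<open>g\<close> up to null sets; the case \<open>u = 0\<close> says that the total mass is 1.
\<close>

definition stable_subordinator_density :: "real \<Rightarrow> (real \<Rightarrow> real \<Rightarrow> real) \<Rightarrow> bool" where
  "stable_subordinator_density \<alpha> g \<longleftrightarrow>
     (\<forall>t>0. (\<lambda>x. g x t) \<in> borel_measurable borel \<and>
        (\<forall>x>0. 0 \<le> g x t) \<and>
        (\<forall>u\<ge>0. (\<integral>\<^sup>+x\<in>{0<..}. ennreal (exp (- u * x) * g x t) \<partial>lborel)
                = ennreal (exp (- t * u powr \<alpha>))))"

context prob_space
begin

definition tempered_stable_subordinator :: "real \<Rightarrow> real \<Rightarrow> (real \<Rightarrow> 'a \<Rightarrow> real) \<Rightarrow> bool" where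
  "tempered_stable_subordinator \<alpha> \<mu> S \<longleftrightarrow>
     subordinator S \<and>
     (\<exists>g. stable_subordinator_density \<alpha> g \<and>
        (\<forall>t>0. distributed M lborel (S t)
           (\<lambda>x. ennreal (indicator {0<..} x * (exp (- \<mu> * x + \<mu> powr \<alpha> * t) * g x t)))))"

text \<open>Independence of the whole processes, as random elements of the path space.\<close>

definition independent_processes ::
  "(real \<Rightarrow> 'a \<Rightarrow> real) \<Rightarrow> (real \<Rightarrow> 'a \<Rightarrow> real) \<Rightarrow> bool" where
  "independent_processes X Y \<longleftrightarrow>
     indep_var (PiM {0..} (\<lambda>_. borel)) (\<lambda>\<omega>. \<lambda>t\<in>{0..}. X t \<omega>)
               (PiM {0..} (\<lambda>_. borel)) (\<lambda>\<omega>. \<lambda>t\<in>{0..}. Y t \<omega>)"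

definition tempered_mittag_leffler_levy_process ::
  "real \<Rightarrow> real \<Rightarrow> real \<Rightarrow> real \<Rightarrow> (real \<Rightarrow> 'a \<Rightarrow> real) \<Rightarrow> bool" where
  "tempered_mittag_leffler_levy_process \<alpha> \<beta> lambda \<mu> Z \<longleftrightarrow>
     (\<exists>S G. tempered_stable_subordinator \<alpha> \<mu> S \<and>
            gamma_subordinator lambda \<beta> G \<and>
            independent_processes S G \<and>
            (\<forall>t\<ge>0. \<forall>\<omega>\<in>space M. Z t \<omega> = S (G t \<omega>) \<omega>))"

end

end

theory Submission
  imports Defs
begin

text \<open>
  With \<open>c = \<alpha> \<beta>\<^sub>1 \<mu>\<^bsup>\<alpha>-1\<^esup> / lambda\<^sub>1\<close>, on \<open>x \<ge> 0\<close> the function \<open>\<bar>x powr q - c powr q\<bar>\<close> is at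
  most \<open>\<epsilon> + K (cosh (x - c) - 1)\<close>, since both vanish at \<open>c\<close> and \<open>cosh\<close> outgrows every power.
  So \<open>E (Z t / t)\<^sup>q \<rightarrow> c\<^sup>q\<close> follows once the exponential moments of \<open>Z t / t\<close> at \<open>1\<close> and \<open>-1\<close>
  are asymptotically at most \<open>exp c\<close> and \<open>exp (- c)\<close>. Tempering makes the Laplace transform
  formula valid for all arguments \<open>u \<ge> -\<mu>\<close> at which its denominator is positive, in particular
  for \<open>u = \<plusminus>1 / t\<close> with \<open>t\<close> large, and its limit there is read off from a derivative at \<open>0\<close>.
\<close>

section \<open>Power moments controlled by two exponential moments\<close>

text \<open>Near \<open>c\<close>, continuity of the power gives the bound by
  \<open>\<epsilon>\<close>. Away from \<open>c\<close>, \<open>cosh (x - c) - 1\<close> stays above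
  a positive constant, so a multiple of it absorbs both the power of \<open>x\<close> and the
  constant \<open>c powr q\<close>.\<close>

lemma powr_diff_le_cosh:
  fixes c q \<epsilon> :: real
  assumes c: "0 < c" and q: "0 < q" and \<epsilon>: "0 < \<epsilon>"
  shows "\<exists>K>0. \<forall>x\<ge>0. \<bar>x powr q - c powr q\<bar> \<le> \<epsilon> + K * (cosh (x - c) - 1)"
proof -
  have "isCont (\<lambda>x. x powr q) c"
    using c by (intro continuous_intros) auto
  then obtain \<delta> where \<delta>: "0 < \<delta>" "\<And>x. \<bar>x - c\<bar> < \<delta> \<Longrightarrow> \<bar>x powr q - c powr q\<bar> < \<epsilon>"
    using \<epsilon> unfolding continuous_at_eps_delta dist_real_def by blast
  \<comment> \<open>The least value of \<open>cosh (x - c) - 1\<close> outside the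
    \<open>\<delta>\<close>-neighbourhood of \<open>c\<close>.\<close>
  define h0 where "h0 = cosh \<delta> - 1"
  have h0: "0 < h0"
    unfolding h0_def using \<delta>(1) cosh_real_nonneg_less_iff[of 0 \<delta>] by simp
  \<comment> \<open>Chosen so that \<open>x powr q + c powr q \<le> C * cosh (x - c)\<close> on
    \<open>x \<ge> 0\<close>. Writing \<open>cosh\<close> as \<open>(cosh - 1) + 1\<close> leaves a
    summand \<open>C\<close>, which the part \<open>C / h0\<close> of \<open>K\<close> pays
    for.\<close>
  define C where "C = 2 * q powr q * exp c + c powr q"
  have C: "0 < C"
    unfolding C_def using q c by (intro add_pos_pos mult_pos_pos) auto
  define K where "K = C + C / h0"
  have K: "0 < K" unfolding K_def using C h0 by (intro add_pos_pos divide_pos_pos)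
  have "\<bar>x powr q - c powr q\<bar> \<le> \<epsilon> + K * (cosh (x - c) - 1)" if x: "0 \<le> x" for x
  proof (cases "\<bar>x - c\<bar> < \<delta>")
    case True
    moreover have "0 \<le> K * (cosh (x - c) - 1)"
      using K cosh_real_ge_1[of "x - c"] by (intro mult_nonneg_nonneg) auto
    ultimately show ?thesis
      using \<delta>(2)[of x] by linarith
  next
    case False
    have h: "h0 \<le> cosh (x - c) - 1"
      unfolding h0_def using False \<delta>(1) cosh_real_nonneg_le_iff[of \<delta> "\<bar>x - c\<bar>"] by simp
    \<comment> \<open>This is \<open>y \<le> exp y\<close> at \<open>y = x / q\<close>, raised to
      the power \<open>q\<close>.\<close>
    have "x powr q \<le> q powr q * exp x"
    proof (cases "x = 0")
      case True
      then show ?thesis using q by simp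
    next
      case False
      then have xp: "0 < x" using x by simp
      have "x / q \<le> exp (x / q)"
        using exp_ge_add_one_self[of "x / q"] by linarith
      then have "(x / q) powr q \<le> exp (x / q) powr q"
        using xp q by (intro powr_mono2) auto
      also have "\<dots> = exp x" using q by (simp add: powr_def)
      finally show ?thesis using xp q
        by (simp add: powr_divide field_simps)
    qed
    also have "\<dots> = q powr q * exp c * exp (x - c)"
      by (simp add: exp_diff)
    also have "\<dots> \<le> q powr q * exp c * (2 * cosh (x - c))"
      by (intro mult_left_mono) (auto simp: cosh_def)
    finally have 1: "x powr q \<le> (2 * q powr q * exp c) * cosh (x - c)"
      by (simp add: mult_ac)
    have "c powr q * 1 \<le> c powr q * cosh (x - c)"
      by (intro mult_left_mono cosh_real_ge_1) auto
    then have "x powr q + c powr q \<le> C * cosh (x - c)"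
      using 1 unfolding C_def by (simp add: algebra_simps)
    also have "\<dots> = C * (cosh (x - c) - 1) + C * 1"
      by (simp add: algebra_simps)
    also have "C * 1 \<le> C * ((cosh (x - c) - 1) / h0)"
      using C h h0 by (intro mult_left_mono) auto
    also have "C * (cosh (x - c) - 1) + C * ((cosh (x - c) - 1) / h0) = K * (cosh (x - c) - 1)"
      by (simp add: K_def distrib_right)
    finally show ?thesis
      using \<epsilon> by (smt (verit) powr_ge_zero)
  qed
  then show ?thesis using K by blast
qed

text \<open>The pointwise \<open>cosh\<close> bound is integrated. The expectation of
  \<open>cosh (X i - c)\<close> is a combination of the exponential moments at \<open>1\<close> and
  \<open>-1\<close>, so upper bounds on these two force concentration at \<open>c\<close>.\<close>

lemma (in prob_space) tendsto_expectation_powr: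
  fixes X :: "'i \<Rightarrow> 'a \<Rightarrow> real" and c q :: real
  assumes c: "0 < c" and q: "0 < q"
    and meas: "eventually (\<lambda>i. random_variable borel (X i)) F"
    and nonneg: "eventually (\<lambda>i. \<forall>\<omega>\<in>space M. 0 \<le> X i \<omega>) F"
    and pos: "eventually (\<lambda>i. (\<integral>\<^sup>+\<omega>. ennreal (exp (X i \<omega>)) \<partial>M) \<le> ennreal (a i)) F"
    and neg: "eventually (\<lambda>i. (\<integral>\<^sup>+\<omega>. ennreal (exp (- X i \<omega>)) \<partial>M) \<le> ennreal (b i)) F"
    and a: "(a \<longlongrightarrow> exp c) F" and b: "(b \<longlongrightarrow> exp (- c)) F"
  shows "((\<lambda>i. expectation (\<lambda>\<omega>. X i \<omega> powr q)) \<longlongrightarrow> c powr q) F"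
proof (rule tendstoI)
  fix e :: real assume e: "0 < e"
  then obtain K where K: "0 < K"
    "\<And>x. 0 \<le> x \<Longrightarrow> \<bar>x powr q - c powr q\<bar> \<le> e / 2 + K * (cosh (x - c) - 1)"
    using powr_diff_le_cosh[OF c q, of "e / 2"] by auto
  \<comment> \<open>An upper bound for the expectation of \<open>cosh (X i - c) - 1\<close>. It
    tends to 0 because both products in the limit are \<open>exp (- c) * exp c = 1\<close>.\<close>
  define h where "h i = (exp (- c) * a i + exp c * b i) / 2 - 1" for i
  have "(h \<longlongrightarrow> (exp (- c) * exp c + exp c * exp (- c)) / 2 - 1) F"
    unfolding h_def by (intro tendsto_intros a b) auto
  then have "((\<lambda>i. e / 2 + K * h i) \<longlongrightarrow> e / 2 + K * 0) F"
    by (intro tendsto_intros) (auto simp: exp_minus)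
  then have ev: "eventually (\<lambda>i. e / 2 + K * h i < e) F"
    using e by (elim order_tendstoD) auto
  \<comment> \<open>Since \<open>ennreal\<close> sends negative reals to 0, positivity of the bounds
    is what turns the \<open>ennreal\<close> inequalities into real ones.\<close>
  have "eventually (\<lambda>i. 0 < a i) F" "eventually (\<lambda>i. 0 < b i) F"
    using order_tendstoD(1)[OF a, of 0] order_tendstoD(1)[OF b, of 0] by auto
  with meas nonneg pos neg ev
  show "eventually (\<lambda>i. dist (expectation (\<lambda>\<omega>. X i \<omega> powr q)) (c powr q) < e) F"
  proof eventually_elim
    case (elim i)
    note [measurable] = elim(1)
    have int: "integrable M (\<lambda>\<omega>. exp (X i \<omega>))" "integrable M (\<lambda>\<omega>. exp (- X i \<omega>))"
      using elim(3,4) by (auto intro!: integrableI_nonneg le_less_trans[OF _ ennreal_less_top])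
    have le: "expectation (\<lambda>\<omega>. exp (X i \<omega>)) \<le> a i" "expectation (\<lambda>\<omega>. exp (- X i \<omega>)) \<le> b i"
      using elim(3-) int by (simp_all add: nn_integral_eq_integral)
    have cosh_eq: "cosh (X i \<omega> - c) = (exp (- c) * exp (X i \<omega>) + exp c * exp (- X i \<omega>)) / 2" for \<omega>
      by (simp add: cosh_def exp_add[symmetric] add_ac)
    have int_cosh: "integrable M (\<lambda>\<omega>. e / 2 + K * (cosh (X i \<omega> - c) - 1))"
      unfolding cosh_eq using int by auto
    \<comment> \<open>Domination by the \<open>cosh\<close> bound yields a finite
      \<open>q\<close>-th moment. Integrability must be established because
      \<open>expectation\<close> defaults to 0 otherwise.\<close>
    have int_diff: "integrable M (\<lambda>\<omega>. \<bar>X i \<omega> powr q - c powr q\<bar>)"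
      by (rule Bochner_Integration.integrable_bound[OF int_cosh])
         (use K(2) elim(2) in \<open>auto intro!: AE_I2 order_trans[OF _ abs_ge_self]\<close>)
    have int_diff': "integrable M (\<lambda>\<omega>. X i \<omega> powr q - c powr q)"
      using int_diff by (subst integrable_abs_iff[symmetric]) auto
    have "integrable M (\<lambda>\<omega>. (X i \<omega> powr q - c powr q) + c powr q)"
      by (intro Bochner_Integration.integrable_add int_diff') auto
    then have int_powr: "integrable M (\<lambda>\<omega>. X i \<omega> powr q)" by simp
    have "expectation (\<lambda>\<omega>. X i \<omega> powr q) - c powr q = expectation (\<lambda>\<omega>. X i \<omega> powr q - c powr q)"
      using int_powr by (simp add: prob_space)
    then have "\<bar>expectation (\<lambda>\<omega>. X i \<omega> powr q) - c powr q\<bar>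
        \<le> expectation (\<lambda>\<omega>. \<bar>X i \<omega> powr q - c powr q\<bar>)"
      using integral_abs_bound[of M "\<lambda>\<omega>. X i \<omega> powr q - c powr q"] by simp
    also have "\<dots> \<le> expectation (\<lambda>\<omega>. e / 2 + K * (cosh (X i \<omega> - c) - 1))"
      using K(2) elim(2) by (intro integral_mono int_diff int_cosh) auto
    also have "\<dots> = e / 2 + K * ((exp (- c) * expectation (\<lambda>\<omega>. exp (X i \<omega>)) +
        exp c * expectation (\<lambda>\<omega>. exp (- X i \<omega>))) / 2 - 1)"
      unfolding cosh_eq using int by (simp add: prob_space)
    also have "\<dots> \<le> e / 2 + K * h i"
      unfolding h_def using K(1) le by (intro add_left_mono mult_left_mono diff_right_mono divide_right_mono add_mono) auto
    finally show ?case using elim(5) by (simp add: dist_real_def)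
  qed
qed

section \<open>Independence and countably valued random indices\<close>

text \<open>The joint law is the product of the marginals, and Tonelli splits the integral.\<close>

lemma (in prob_space) indep_var_nn_integral_mult:
  fixes f :: "'b \<Rightarrow> ennreal" and g :: "'b \<Rightarrow> ennreal"
  assumes indep: "indep_var S X T Y"
    and f[measurable]: "f \<in> borel_measurable S" and g[measurable]: "g \<in> borel_measurable T"
  shows "(\<integral>\<^sup>+\<omega>. f (X \<omega>) * g (Y \<omega>) \<partial>M) = (\<integral>\<^sup>+\<omega>. f (X \<omega>) \<partial>M) * (\<integral>\<^sup>+\<omega>. g (Y \<omega>) \<partial>M)"
proof -
  note [measurable] = indep_var_rv1[OF indep] indep_var_rv2[OF indep]
  interpret Y: prob_space "distr M T Y" by (rule prob_space_distr) measurable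
  have "(\<integral>\<^sup>+\<omega>. f (X \<omega>) * g (Y \<omega>) \<partial>M) =
      (\<integral>\<^sup>+p. f (fst p) * g (snd p) \<partial>distr M (S \<Otimes>\<^sub>M T) (\<lambda>\<omega>. (X \<omega>, Y \<omega>)))"
    by (subst nn_integral_distr) auto
  also have "distr M (S \<Otimes>\<^sub>M T) (\<lambda>\<omega>. (X \<omega>, Y \<omega>)) = distr M S X \<Otimes>\<^sub>M distr M T Y"
    using indep by (simp add: indep_var_distribution_eq)
  also have "(\<integral>\<^sup>+p. f (fst p) * g (snd p) \<partial>(distr M S X \<Otimes>\<^sub>M distr M T Y)) =
      (\<integral>\<^sup>+x. \<integral>\<^sup>+y. f x * g y \<partial>distr M T Y \<partial>distr M S X)"
    by (subst Y.nn_integral_fst[symmetric]) auto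
  also have "\<dots> = (\<integral>\<^sup>+x. f x \<partial>distr M S X) * (\<integral>\<^sup>+y. g y \<partial>distr M T Y)"
    by (simp add: nn_integral_cmult nn_integral_multc)
  finally show ?thesis by (simp add: nn_integral_distr)
qed

text \<open>On each event \<open>k (Y \<omega>) = j\<close> the index is frozen, so
  \<open>f (X j)\<close> factors from the indicator by independence; summing over \<open>j\<close>
  gives the claim. One \<open>X j\<close> at a time meets \<open>Y\<close>, hence pairwise
  independence suffices.\<close>

lemma (in prob_space) nn_integral_compose_countable_indep:
  fixes X :: "nat \<Rightarrow> 'a \<Rightarrow> 'b" and f :: "'b \<Rightarrow> ennreal"
  assumes indep: "\<And>j. indep_var S (X j) T Y"
    and f[measurable]: "f \<in> borel_measurable S"
    and k[measurable]: "k \<in> measurable T (count_space UNIV)"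
  shows "(\<integral>\<^sup>+\<omega>. f (X (k (Y \<omega>)) \<omega>) \<partial>M) = (\<integral>\<^sup>+\<omega>. (\<integral>\<^sup>+\<omega>'. f (X (k (Y \<omega>)) \<omega>') \<partial>M) \<partial>M)"
proof -
  note [measurable] = indep_var_rv1[OF indep] indep_var_rv2[OF indep]
  let ?A = "\<lambda>j. {y. k y = j}"
  have single: "(\<Sum>j. g j * indicator (?A j) y) = g (k y)" for g :: "nat \<Rightarrow> ennreal" and y
    by (rule suminf_cmult_indicator) (auto simp: disjoint_family_on_def)
  have [measurable]: "(\<lambda>y. indicator (?A j) y :: ennreal) \<in> borel_measurable T" for j
  proof -
    have "(\<lambda>y. indicator {j} (k y) :: ennreal) \<in> borel_measurable T"
      by (rule measurable_compose[OF k]) simp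
    also have "(\<lambda>y. indicator {j} (k y) :: ennreal) = indicator (?A j)"
      by (auto simp: indicator_def)
    finally show ?thesis .
  qed
  have "(\<integral>\<^sup>+\<omega>. f (X (k (Y \<omega>)) \<omega>) \<partial>M) =
      (\<integral>\<^sup>+\<omega>. (\<Sum>j. f (X j \<omega>) * indicator (?A j) (Y \<omega>)) \<partial>M)"
    by (simp add: single)
  also have "\<dots> = (\<Sum>j. \<integral>\<^sup>+\<omega>. f (X j \<omega>) * indicator (?A j) (Y \<omega>) \<partial>M)"
    by (rule nn_integral_suminf) measurable
  also have "\<dots> = (\<Sum>j. \<integral>\<^sup>+\<omega>. (\<integral>\<^sup>+\<omega>'. f (X j \<omega>') \<partial>M) * indicator (?A j) (Y \<omega>) \<partial>M)"
    by (simp add: indep_var_nn_integral_mult[OF indep] nn_integral_cmult)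
  also have "\<dots> = (\<integral>\<^sup>+\<omega>. (\<Sum>j. (\<integral>\<^sup>+\<omega>'. f (X j \<omega>') \<partial>M) * indicator (?A j) (Y \<omega>)) \<partial>M)"
    by (rule nn_integral_suminf[symmetric]) measurable
  finally show ?thesis by (simp add: single)
qed

section \<open>Approximation of times from above by grid points\<close>

text \<open>For \<open>x \<ge> 0\<close> this is the least multiple of \<open>1 / Suc n\<close>
  strictly above \<open>x\<close>. Strictness keeps the approximation on the right of
  \<open>x\<close> and makes every grid time positive, where laws are given by densities. For
  negative \<open>x\<close>, \<open>nat\<close> truncates and the value is still a positive grid
  point.\<close>

definition grid_above :: "nat \<Rightarrow> real \<Rightarrow> real" where
  "grid_above n x = real (Suc (nat \<lfloor>real (Suc n) * x\<rfloor>)) / real (Suc n)"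

lemma
  assumes "0 \<le> x"
  shows grid_above_gt: "x < grid_above n x"
    and grid_above_le: "grid_above n x \<le> x + 1 / real (Suc n)"
proof -
  have "0 \<le> real (Suc n) * x" using assms by simp
  then have "real (nat \<lfloor>real (Suc n) * x\<rfloor>) = of_int \<lfloor>real (Suc n) * x\<rfloor>"
    by (simp add: of_nat_nat)
  then have "real (Suc n) * x < real (Suc (nat \<lfloor>real (Suc n) * x\<rfloor>))"
    "real (Suc (nat \<lfloor>real (Suc n) * x\<rfloor>)) \<le> real (Suc n) * x + 1"
    by linarith+
  then show "x < grid_above n x" "grid_above n x \<le> x + 1 / real (Suc n)"
    unfolding grid_above_def by (simp_all add: field_simps del: of_nat_Suc)
qed

lemma grid_above_tendsto:
  assumes "0 \<le> x"
  shows "filterlim (\<lambda>n. grid_above n x) (at_right x) sequentially"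
proof (rule tendsto_imp_filterlim_at_right)
  show "(\<lambda>n. grid_above n x) \<longlonglongrightarrow> x"
  proof (rule tendsto_sandwich[where f = "\<lambda>_. x" and h = "\<lambda>n. x + 1 / real (Suc n)"])
    show "(\<lambda>n. x + 1 / real (Suc n)) \<longlonglongrightarrow> x"
      using tendsto_add[OF tendsto_const[of x] LIMSEQ_inverse_real_of_nat] by (simp add: inverse_eq_divide)
  qed (use grid_above_gt[OF assms] grid_above_le[OF assms] in
      \<open>auto intro!: always_eventually less_imp_le simp del: of_nat_Suc\<close>)
qed (use grid_above_gt[OF assms] in auto)

lemma tendsto_grid_above_path:
  fixes f :: "real \<Rightarrow> real"
  assumes "0 \<le> x" and "continuous (at_right x) f"
  shows "(\<lambda>n. f (grid_above n x)) \<longlonglongrightarrow> f x"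
proof -
  have "(f \<longlongrightarrow> f x) (at_right x)"
    using assms(2) by (simp add: continuous_within)
  then show ?thesis
    by (rule filterlim_compose) (rule grid_above_tendsto[OF assms(1)])
qed

section \<open>Evaluating a process at an independent random time\<close>

text \<open>Isolates what subordination uses of \<open>S\<close> and \<open>G t\<close>:
  right-continuous paths, a nonnegative time, and independence of each single value of the process
  from that time.\<close>

locale independent_time_change = prob_space +
  fixes Y :: "real \<Rightarrow> 'a \<Rightarrow> real" and T :: "'a \<Rightarrow> real"
  assumes cont: "\<And>y \<omega>. 0 \<le> y \<Longrightarrow> \<omega> \<in> space M \<Longrightarrow> continuous (at_right y) (\<lambda>t. Y t \<omega>)"
    and T_nonneg: "\<And>\<omega>. \<omega> \<in> space M \<Longrightarrow> 0 \<le> T \<omega>"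
    and indep: "\<And>y. 0 \<le> y \<Longrightarrow> indep_var borel (Y y) borel T"
begin

lemma measurable_T[measurable]: "random_variable borel T"
  using indep_var_rv2[OF indep[of 0]] by simp

lemma measurable_Y: "0 \<le> y \<Longrightarrow> random_variable borel (Y y)"
  by (rule indep_var_rv1[OF indep])

lemma measurable_grid_subordinated[measurable]:
  "random_variable borel (\<lambda>\<omega>. Y (grid_above n (T \<omega>)) \<omega>)"
  unfolding grid_above_def
  by (rule measurable_compose_countable[where f = "\<lambda>j. Y (real (Suc j) / real (Suc n))"])
     (auto intro!: measurable_Y)

text \<open>The grid versions use only countably many times and are therefore measurable; by
  right-continuity they converge at every outcome.\<close>

lemma measurable_subordinated: "random_variable borel (\<lambda>\<omega>. Y (T \<omega>) \<omega>)"
proof (rule borel_measurable_LIMSEQ_real)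
  show "(\<lambda>n. Y (grid_above n (T \<omega>)) \<omega>) \<longlonglongrightarrow> Y (T \<omega>) \<omega>" if "\<omega> \<in> space M" for \<omega>
    using that by (intro tendsto_grid_above_path[where f = "\<lambda>t. Y t \<omega>"] cont T_nonneg)
qed measurable

text \<open>
  Equality holds as well, but the inequality needs no domination: it is Fatou's lemma applied
  to the approximation of \<open>T\<close> by grid points from above.
\<close>

lemma nn_integral_exp_subordinated_le:
  fixes s k :: real
  assumes exp_Y: "\<And>y. 0 < y \<Longrightarrow> (\<integral>\<^sup>+\<omega>. ennreal (exp (s * Y y \<omega>)) \<partial>M) = ennreal (exp (- (k * y)))"
  shows "(\<integral>\<^sup>+\<omega>. ennreal (exp (s * Y (T \<omega>) \<omega>)) \<partial>M) \<le> (\<integral>\<^sup>+\<omega>. ennreal (exp (- (k * T \<omega>))) \<partial>M)"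
    (is "_ \<le> ?R")
proof -
  let ?Z = "\<lambda>n \<omega>. ennreal (exp (s * Y (grid_above n (T \<omega>)) \<omega>))"
  \<comment> \<open>Replacing the grid time by \<open>T\<close> shifts the exponent by at most
    \<open>\<bar>k\<bar>\<close> times the mesh, whatever the sign of \<open>k\<close>.\<close>
  have grid: "(\<integral>\<^sup>+\<omega>. ?Z n \<omega> \<partial>M) \<le> ennreal (exp (\<bar>k\<bar> * (1 / real (Suc n)))) * ?R" for n
  proof -
    have "(\<integral>\<^sup>+\<omega>. ?Z n \<omega> \<partial>M) =
        (\<integral>\<^sup>+\<omega>. (\<integral>\<^sup>+\<omega>'. ennreal (exp (s * Y (grid_above n (T \<omega>)) \<omega>')) \<partial>M) \<partial>M)"
      unfolding grid_above_def
      by (rule nn_integral_compose_countable_indep[where f = "\<lambda>x. ennreal (exp (s * x))" and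
            X = "\<lambda>j. Y (real (Suc j) / real (Suc n))" and k = "\<lambda>x. nat \<lfloor>real (Suc n) * x\<rfloor>"])
         (auto intro!: indep)
    also have "\<dots> = (\<integral>\<^sup>+\<omega>. ennreal (exp (- (k * grid_above n (T \<omega>)))) \<partial>M)"
      using T_nonneg grid_above_gt by (intro nn_integral_cong exp_Y) (meson le_less_trans)
    also have "\<dots> \<le> (\<integral>\<^sup>+\<omega>. ennreal (exp (\<bar>k\<bar> * (1 / real (Suc n)))) * ennreal (exp (- (k * T \<omega>))) \<partial>M)"
    proof (rule nn_integral_mono)
      fix \<omega> assume "\<omega> \<in> space M"
      then have g: "0 \<le> grid_above n (T \<omega>) - T \<omega>" "grid_above n (T \<omega>) - T \<omega> \<le> 1 / real (Suc n)"
        using grid_above_gt[OF T_nonneg, of \<omega> n] grid_above_le[OF T_nonneg, of \<omega> n] by auto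
      have "- k * (grid_above n (T \<omega>) - T \<omega>) \<le> \<bar>k\<bar> * (1 / real (Suc n))"
        using g by (intro mult_mono) auto
      then have "- (k * grid_above n (T \<omega>)) \<le> \<bar>k\<bar> * (1 / real (Suc n)) + - (k * T \<omega>)"
        by (simp add: algebra_simps)
      then show "ennreal (exp (- (k * grid_above n (T \<omega>))))
          \<le> ennreal (exp (\<bar>k\<bar> * (1 / real (Suc n)))) * ennreal (exp (- (k * T \<omega>)))"
        by (simp add: ennreal_mult[symmetric] exp_add[symmetric] del: of_nat_Suc)
    qed
    also have "\<dots> = ennreal (exp (\<bar>k\<bar> * (1 / real (Suc n)))) * ?R"
      by (rule nn_integral_cmult) measurable
    finally show ?thesis .
  qed
  have "(\<integral>\<^sup>+\<omega>. ennreal (exp (s * Y (T \<omega>) \<omega>)) \<partial>M) = (\<integral>\<^sup>+\<omega>. liminf (\<lambda>n. ?Z n \<omega>) \<partial>M)"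
  proof (rule nn_integral_cong)
    fix \<omega> assume "\<omega> \<in> space M"
    then have "(\<lambda>n. ?Z n \<omega>) \<longlonglongrightarrow> ennreal (exp (s * Y (T \<omega>) \<omega>))"
      by (intro tendsto_ennrealI tendsto_exp tendsto_mult_left
            tendsto_grid_above_path[where f = "\<lambda>t. Y t \<omega>"] cont T_nonneg)
    then show "ennreal (exp (s * Y (T \<omega>) \<omega>)) = liminf (\<lambda>n. ?Z n \<omega>)"
      by (rule lim_imp_Liminf[OF sequentially_bot, symmetric])
  qed
  also have "\<dots> \<le> liminf (\<lambda>n. \<integral>\<^sup>+\<omega>. ?Z n \<omega> \<partial>M)"
    by (rule nn_integral_liminf) measurable
  also have "\<dots> \<le> liminf (\<lambda>n. ennreal (exp (\<bar>k\<bar> * (1 / real (Suc n)))) * ?R)"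
    by (intro Liminf_mono always_eventually allI grid)
  also have "\<dots> = ennreal (exp (\<bar>k\<bar> * 0)) * ?R"
  proof (rule lim_imp_Liminf[OF sequentially_bot])
    have "(\<lambda>n. 1 / real (Suc n)) \<longlonglongrightarrow> 0"
      using LIMSEQ_inverse_real_of_nat by (simp add: inverse_eq_divide)
    then have "(\<lambda>n. ennreal (exp (\<bar>k\<bar> * (1 / real (Suc n))))) \<longlonglongrightarrow> ennreal (exp (\<bar>k\<bar> * 0))"
      by (intro tendsto_ennrealI tendsto_exp tendsto_mult_left)
    then show "(\<lambda>n. ennreal (exp (\<bar>k\<bar> * (1 / real (Suc n)))) * ?R)
        \<longlonglongrightarrow> ennreal (exp (\<bar>k\<bar> * 0)) * ?R"
      by (rule tendsto_mult_ennreal[OF _ tendsto_const]) auto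
  qed
  finally show ?thesis by simp
qed

end

section \<open>Exponential moments of the two subordinators and of their composition\<close>

context prob_space
begin

text \<open>Multiplying the tempered density by \<open>exp (s * x)\<close> gives the untempered
  density with weight \<open>exp (- (\<mu> - s) * x)\<close>. The condition
  \<open>s \<le> \<mu>\<close> places \<open>\<mu> - s\<close> in the range of the stable Laplace
  transform.\<close>

lemma tempered_stable_exp_moment:
  assumes S: "tempered_stable_subordinator \<alpha> \<mu> S" and y: "0 < y" and s: "s \<le> \<mu>"
  shows "(\<integral>\<^sup>+\<omega>. ennreal (exp (s * S y \<omega>)) \<partial>M)
    = ennreal (exp (- (((\<mu> - s) powr \<alpha> - \<mu> powr \<alpha>) * y)))"
proof -
  obtain g where g: "stable_subordinator_density \<alpha> g"
    and d: "distributed M lborel (S y)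
      (\<lambda>x. ennreal (indicator {0<..} x * (exp (- \<mu> * x + \<mu> powr \<alpha> * y) * g x y)))"
    using S y unfolding tempered_stable_subordinator_def by blast
  have [measurable]: "(\<lambda>x. g x y) \<in> borel_measurable borel"
    and g0: "\<And>x. 0 < x \<Longrightarrow> 0 \<le> g x y"
    and lap: "(\<integral>\<^sup>+x\<in>{0<..}. ennreal (exp (- (\<mu> - s) * x) * g x y) \<partial>lborel)
      = ennreal (exp (- y * (\<mu> - s) powr \<alpha>))"
    using g y s unfolding stable_subordinator_density_def by (simp_all only: diff_ge_0_iff_ge)
  have "(\<integral>\<^sup>+\<omega>. ennreal (exp (s * S y \<omega>)) \<partial>M) = (\<integral>\<^sup>+x. ennreal (indicator {0<..} x *
      (exp (- \<mu> * x + \<mu> powr \<alpha> * y) * g x y)) * ennreal (exp (s * x)) \<partial>lborel)"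
    by (rule distributed_nn_integral[OF d, symmetric]) measurable
  also have "\<dots> = (\<integral>\<^sup>+x. ennreal (exp (\<mu> powr \<alpha> * y)) *
      (ennreal (exp (- (\<mu> - s) * x) * g x y) * indicator {0<..} x) \<partial>lborel)"
  proof (rule nn_integral_cong)
    fix x :: real
    show "ennreal (indicator {0<..} x * (exp (- \<mu> * x + \<mu> powr \<alpha> * y) * g x y)) * ennreal (exp (s * x)) =
        ennreal (exp (\<mu> powr \<alpha> * y)) * (ennreal (exp (- (\<mu> - s) * x) * g x y) * indicator {0<..} x)"
    proof (cases "0 < x")
      case True
      have "exp (- \<mu> * x + \<mu> powr \<alpha> * y) * g x y * exp (s * x) =
          exp (\<mu> powr \<alpha> * y) * (exp (- (\<mu> - s) * x) * g x y)"
        by (simp add: exp_add[symmetric] algebra_simps mult_exp_exp)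
      then show ?thesis using True g0[OF True]
        by (simp add: ennreal_mult'[symmetric] ennreal_mult''[symmetric])
    qed simp
  qed
  also have "\<dots> = ennreal (exp (\<mu> powr \<alpha> * y)) * ennreal (exp (- y * (\<mu> - s) powr \<alpha>))"
    by (subst nn_integral_cmult, measurable) (simp only: lap)
  finally show ?thesis
    by (simp add: ennreal_mult[symmetric] exp_add[symmetric] algebra_simps)
qed

text \<open>Substituting \<open>(l + w) * x\<close> turns the moment into the Euler integral for
  \<open>Gamma p\<close>; \<open>0 < l + w\<close> makes it converge and allows negative
  \<open>w\<close>.\<close>

lemma gamma_exp_moment:
  assumes G: "gamma_subordinator l \<beta> G" and l: "0 < l" and \<beta>: "0 < \<beta>" and t: "0 < t"
    and w: "0 < l + w"
  shows "(\<integral>\<^sup>+\<omega>. ennreal (exp (- (w * G t \<omega>))) \<partial>M) = ennreal ((l / (l + w)) powr (\<beta> * t))"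
proof -
  define p where "p = \<beta> * t"
  have p: "0 < p" unfolding p_def using \<beta> t by simp
  have d: "distributed M lborel (G t)
      (\<lambda>x. ennreal (indicator {0<..} x * (l powr p / Gamma p * x powr (p - 1) * exp (- l * x))))"
    using G t unfolding gamma_subordinator_def p_def by blast
  have Gp: "0 < Gamma p" using p by simp
  let ?f = "\<lambda>x. ennreal (indicator {0..} x * x powr (p - 1) / exp x)"
  have "(\<integral>\<^sup>+\<omega>. ennreal (exp (- (w * G t \<omega>))) \<partial>M) = (\<integral>\<^sup>+x. ennreal (indicator {0<..} x *
      (l powr p / Gamma p * x powr (p - 1) * exp (- l * x))) * ennreal (exp (- (w * x))) \<partial>lborel)"
    by (rule distributed_nn_integral[OF d, symmetric]) measurable
  also have "\<dots> = (\<integral>\<^sup>+x. ennreal (l powr p / Gamma p * (l + w) powr (1 - p)) * ?f (0 + (l + w) * x) \<partial>lborel)"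
  proof (rule nn_integral_cong)
    fix x :: real
    show "ennreal (indicator {0<..} x * (l powr p / Gamma p * x powr (p - 1) * exp (- l * x))) *
        ennreal (exp (- (w * x))) =
        ennreal (l powr p / Gamma p * (l + w) powr (1 - p)) * ?f (0 + (l + w) * x)"
    proof (cases "0 < x")
      case True
      have 1: "((l + w) * x) powr (p - 1) = (l + w) powr (p - 1) * x powr (p - 1)"
        using True w by (simp add: powr_mult)
      have 2: "(l + w) powr (1 - p) * (l + w) powr (p - 1) = 1"
        using w by (simp add: powr_add[symmetric])
      have 3: "exp (- l * x) * exp (- (w * x)) = 1 / exp ((l + w) * x)"
        by (simp add: exp_add[symmetric] exp_minus[symmetric] divide_inverse algebra_simps)
      have "(l powr p / Gamma p * x powr (p - 1) * exp (- l * x)) * exp (- (w * x)) =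
          l powr p / Gamma p * x powr (p - 1) * (exp (- l * x) * exp (- (w * x)))" by simp
      also have "\<dots> = (l powr p / Gamma p * (l + w) powr (1 - p)) * (((l + w) * x) powr (p - 1) / exp ((l + w) * x))"
        unfolding 1 3 using 2 by (simp add: field_simps)
      finally show ?thesis using True Gp w
        by (simp add: ennreal_mult[symmetric] zero_le_mult_iff)
    next
      case False
      \<comment> \<open>At \<open>x = 0\<close> the two indicators differ, but
        \<open>0 powr (p - 1) = 0\<close> by convention, so the integrands agree there as
        well.\<close>
      then have "indicator {0..} ((l + w) * x) * ((l + w) * x) powr (p - 1) = (0::real)"
        using w by (cases "x = 0") (auto simp: indicator_def zero_le_mult_iff)
      then show ?thesis using False by simp
    qed
  qed
  also have "\<dots> = ennreal (l powr p / Gamma p * (l + w) powr (1 - p)) * (\<integral>\<^sup>+x. ?f (0 + (l + w) * x) \<partial>lborel)"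
    by (rule nn_integral_cmult) measurable
  \<comment> \<open>The Jacobian \<open>l + w\<close> and its inverse are inserted to match the form
    of the affine substitution rule.\<close>
  also have "(\<integral>\<^sup>+x. ?f (0 + (l + w) * x) \<partial>lborel) =
      ennreal (1 / (l + w)) * (ennreal (l + w) * (\<integral>\<^sup>+x. ?f (0 + (l + w) * x) \<partial>lborel))"
    using w by (simp add: mult.assoc[symmetric] ennreal_mult[symmetric])
  also have "ennreal (l + w) * (\<integral>\<^sup>+x. ?f (0 + (l + w) * x) \<partial>lborel) = (\<integral>\<^sup>+x. ?f x \<partial>lborel)"
    using w by (subst nn_integral_real_affine[where c = "l + w" and t = 0 and f = ?f]) auto
  also have "\<dots> = ennreal (Gamma p)"
    using Gamma_conv_nn_integral_real[OF p] by simp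
  also have "ennreal (l powr p / Gamma p * (l + w) powr (1 - p)) * (ennreal (1 / (l + w)) * ennreal (Gamma p))
      = ennreal (l powr p / Gamma p * (l + w) powr (1 - p) * (1 / (l + w) * Gamma p))"
    using Gp w by (simp add: ennreal_mult[symmetric])
  also have "l powr p / Gamma p * (l + w) powr (1 - p) * (1 / (l + w) * Gamma p) = (l / (l + w)) powr p"
    using Gp w l by (simp add: powr_diff powr_divide)
  finally show ?thesis by (simp add: p_def)
qed

text \<open>Evaluation at a fixed time is measurable on the product path space and so preserves
  independence.\<close>

lemma independent_processes_indep_var:
  assumes "independent_processes X Y" and "0 \<le> s" and "0 \<le> t"
  shows "indep_var borel (X s) borel (Y t)"
proof -
  have "indep_var borel ((\<lambda>f. f s) \<circ> (\<lambda>\<omega>. \<lambda>t\<in>{0..}. X t \<omega>)) borel ((\<lambda>f. f t) \<circ> (\<lambda>\<omega>. \<lambda>t\<in>{0..}. Y t \<omega>))"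
    using assms unfolding independent_processes_def
    by (intro indep_var_compose) (auto intro!: measurable_component_singleton)
  then show ?thesis using assms(2,3) by (simp add: o_def)
qed

lemma independent_time_change_tempered_mittag_leffler:
  assumes "tempered_stable_subordinator \<alpha> \<mu> S" and "gamma_subordinator l \<beta> G"
    and "independent_processes S G" and "0 \<le> t"
  shows "independent_time_change M S (G t)"
proof
  show "continuous (at_right y) (\<lambda>t. S t \<omega>)" if "0 \<le> y" "\<omega> \<in> space M" for y \<omega>
    using assms that unfolding tempered_stable_subordinator_def subordinator_def
      levy_process_def cadlag_path_def by blast
  show "0 \<le> G t \<omega>" if "\<omega> \<in> space M" for \<omega>
    using assms that unfolding gamma_subordinator_def subordinator_def by blast
  show "indep_var borel (S y) borel (G t)" if "0 \<le> y" for y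
    using independent_processes_indep_var[OF assms(3) that assms(4)] .
qed

lemma tempered_mittag_leffler_measurable:
  assumes "tempered_mittag_leffler_levy_process \<alpha> \<beta> l \<mu> Z" and "0 \<le> t"
  shows "random_variable borel (Z t)"
proof -
  obtain S G where SG: "tempered_stable_subordinator \<alpha> \<mu> S" "gamma_subordinator l \<beta> G"
    "independent_processes S G" "\<And>\<omega>. \<omega> \<in> space M \<Longrightarrow> Z t \<omega> = S (G t \<omega>) \<omega>"
    using assms unfolding tempered_mittag_leffler_levy_process_def by blast
  interpret independent_time_change M S "G t"
    by (rule independent_time_change_tempered_mittag_leffler[OF SG(1-3) assms(2)])
  show ?thesis
    using measurable_subordinated measurable_cong[of M "Z t" "\<lambda>\<omega>. S (G t \<omega>) \<omega>" borel] SG(4)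
    by simp
qed

lemma tempered_mittag_leffler_nonneg:
  assumes "tempered_mittag_leffler_levy_process \<alpha> \<beta> l \<mu> Z" and "0 \<le> t" and "\<omega> \<in> space M"
  shows "0 \<le> Z t \<omega>"
  using assms unfolding tempered_mittag_leffler_levy_process_def
    tempered_stable_subordinator_def gamma_subordinator_def subordinator_def
  by fastforce

text \<open>Conditioning on \<open>G t\<close> leaves the exponential moment of the gamma variable
  at the tempered stable Laplace exponent. The formula is the Laplace transform at
  \<open>u = - s\<close>, extended to positive \<open>s \<le> \<mu>\<close>.\<close>

lemma tempered_mittag_leffler_exp_moment_le:
  assumes Z: "tempered_mittag_leffler_levy_process \<alpha> \<beta> l \<mu> Z"
    and l: "0 < l" and \<beta>: "0 < \<beta>" and t: "0 < t" and s: "s \<le> \<mu>"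
    and w: "0 < l + ((\<mu> - s) powr \<alpha> - \<mu> powr \<alpha>)"
  shows "(\<integral>\<^sup>+\<omega>. ennreal (exp (s * Z t \<omega>)) \<partial>M)
    \<le> ennreal ((l / (l + ((\<mu> - s) powr \<alpha> - \<mu> powr \<alpha>))) powr (\<beta> * t))"
proof -
  obtain S G where SG: "tempered_stable_subordinator \<alpha> \<mu> S" "gamma_subordinator l \<beta> G"
    "independent_processes S G" "\<And>\<omega>. \<omega> \<in> space M \<Longrightarrow> Z t \<omega> = S (G t \<omega>) \<omega>"
    using assms unfolding tempered_mittag_leffler_levy_process_def by (meson less_imp_le)
  interpret independent_time_change M S "G t"
    by (rule independent_time_change_tempered_mittag_leffler[OF SG(1-3) less_imp_le[OF t]])
  have "(\<integral>\<^sup>+\<omega>. ennreal (exp (s * Z t \<omega>)) \<partial>M) = (\<integral>\<^sup>+\<omega>. ennreal (exp (s * S (G t \<omega>) \<omega>)) \<partial>M)"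
    by (intro nn_integral_cong) (simp add: SG(4))
  also have "\<dots> \<le> (\<integral>\<^sup>+\<omega>. ennreal (exp (- (((\<mu> - s) powr \<alpha> - \<mu> powr \<alpha>) * G t \<omega>))) \<partial>M)"
    by (intro nn_integral_exp_subordinated_le tempered_stable_exp_moment[OF SG(1) _ s])
  also have "\<dots> = ennreal ((l / (l + ((\<mu> - s) powr \<alpha> - \<mu> powr \<alpha>))) powr (\<beta> * t))"
    by (rule gamma_exp_moment[OF SG(2) l \<beta> t w])
  finally show ?thesis .
qed

end

section \<open>Limits of the bounds for the exponential moments of \<open>Z t / t\<close>\<close>

text \<open>The logarithm of the bound is \<open>\<beta> * t * \<phi> (r / t)\<close>, that is,
  \<open>r * \<beta>\<close> times a difference quotient of \<open>\<phi>\<close> at 0, so the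
  derivative of \<open>\<phi>\<close> there gives the limit.\<close>

lemma tempered_mittag_leffler_exponent_tendsto:
  fixes \<alpha> \<beta> l \<mu> r :: real
  assumes "0 < l" and "0 < \<mu>" and r: "r \<noteq> 0"
  shows "eventually (\<lambda>t. 0 < l + ((\<mu> - r / t) powr \<alpha> - \<mu> powr \<alpha>)) at_top"
    and "((\<lambda>t. (l / (l + ((\<mu> - r / t) powr \<alpha> - \<mu> powr \<alpha>))) powr (\<beta> * t))
      \<longlongrightarrow> exp (r * (\<alpha> * \<beta> * \<mu> powr (\<alpha> - 1) / l))) at_top"
proof -
  define \<phi> where "\<phi> s = - ln ((l + ((\<mu> - s) powr \<alpha> - \<mu> powr \<alpha>)) / l)" for s
  have "(\<phi> has_field_derivative (\<alpha> * \<mu> powr (\<alpha> - 1) / l)) (at 0)"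
    unfolding \<phi>_def[abs_def] using assms by (auto intro!: derivative_eq_intros simp: field_simps)
  then have "((\<lambda>h. (\<phi> (0 + h) - \<phi> 0) / h) \<longlongrightarrow> \<alpha> * \<mu> powr (\<alpha> - 1) / l) (at 0)"
    by (rule DERIV_D)
  then have lim: "((\<lambda>h. \<phi> h / h) \<longlongrightarrow> \<alpha> * \<mu> powr (\<alpha> - 1) / l) (at 0)"
    using assms by (simp add: \<phi>_def)
  have r0: "((\<lambda>t. r / t) \<longlongrightarrow> 0) at_top"
    by (intro tendsto_divide_0[OF tendsto_const] filterlim_at_top_imp_at_infinity filterlim_ident)
  \<comment> \<open>The punctured filter \<open>at 0\<close> of the difference quotient is reached
    because \<open>r / t\<close> is nonzero.\<close>
  have "filterlim (\<lambda>t. r / t) (at 0) at_top"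
    using r0 r by (auto simp: filterlim_at intro: eventually_mono[OF eventually_gt_at_top[of 0]])
  then have "((\<lambda>t. \<phi> (r / t) / (r / t)) \<longlongrightarrow> \<alpha> * \<mu> powr (\<alpha> - 1) / l) at_top"
    by (rule filterlim_compose[OF lim])
  then have "((\<lambda>t. exp (r * (\<beta> * (\<phi> (r / t) / (r / t))))) \<longlongrightarrow>
      exp (r * (\<beta> * (\<alpha> * \<mu> powr (\<alpha> - 1) / l)))) at_top"
    by (intro tendsto_exp tendsto_mult_left)
  moreover have "((\<lambda>t. l + ((\<mu> - r / t) powr \<alpha> - \<mu> powr \<alpha>))
      \<longlongrightarrow> l + ((\<mu> - 0) powr \<alpha> - \<mu> powr \<alpha>)) at_top"
    using assms by (intro tendsto_intros r0) auto
  then show ev: "eventually (\<lambda>t. 0 < l + ((\<mu> - r / t) powr \<alpha> - \<mu> powr \<alpha>)) at_top"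
    using assms by (intro order_tendstoD(1)) auto
  have "eventually (\<lambda>t. exp (r * (\<beta> * (\<phi> (r / t) / (r / t)))) =
      (l / (l + ((\<mu> - r / t) powr \<alpha> - \<mu> powr \<alpha>))) powr (\<beta> * t)) at_top"
    using ev eventually_gt_at_top[of 0]
  proof eventually_elim
    case (elim t)
    define w where "w = l + ((\<mu> - r / t) powr \<alpha> - \<mu> powr \<alpha>)"
    have w: "0 < w" using elim by (simp add: w_def)
    have e: "r * (\<beta> * (\<phi> (r / t) / (r / t))) = \<beta> * t * ln (l / w)"
      using r elim w assms(1) by (simp add: \<phi>_def w_def[symmetric] ln_div)
    have "exp (\<beta> * t * ln (l / w)) = (l / w) powr (\<beta> * t)"
      using w assms(1) by (simp add: powr_def)
    then show ?case
      by (simp only: e w_def)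
  qed
  ultimately show "((\<lambda>t. (l / (l + ((\<mu> - r / t) powr \<alpha> - \<mu> powr \<alpha>))) powr (\<beta> * t))
      \<longlongrightarrow> exp (r * (\<alpha> * \<beta> * \<mu> powr (\<alpha> - 1) / l))) at_top"
    by (simp add: tendsto_cong mult_ac)
qed

theorem theorem3p3:
  fixes P :: "'w measure"
    and Z :: "real \<Rightarrow> 'w \<Rightarrow> real"
    and \<alpha> \<mu> lambda\<^sub>1 \<beta>\<^sub>1 q :: real
  assumes "prob_space P"
    and "0 < \<alpha>" and "\<alpha> < 1"
    and "0 < \<mu>" and "0 < lambda\<^sub>1" and "0 < \<beta>\<^sub>1"
    and "prob_space.tempered_mittag_leffler_levy_process P \<alpha> \<beta>\<^sub>1 lambda\<^sub>1 \<mu> Z"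
    and "0 < q"
  shows "(\<lambda>t. prob_space.expectation P (\<lambda>\<omega>. Z t \<omega> powr q))
           \<sim>[at_top] (\<lambda>t. (\<alpha> * \<beta>\<^sub>1 * \<mu> powr (\<alpha> - 1) / lambda\<^sub>1) powr q * t powr q)"
proof -
  interpret P: prob_space P by fact
  note Z = assms(7)
  define c where "c = \<alpha> * \<beta>\<^sub>1 * \<mu> powr (\<alpha> - 1) / lambda\<^sub>1"
  have c: "0 < c" unfolding c_def using assms by simp
  \<comment> \<open>The bound for the exponential moment of \<open>Z t / t\<close> at
    \<open>r\<close>, obtained with \<open>s = r / t\<close>.\<close>
  define L where "L r t =
    (lambda\<^sub>1 / (lambda\<^sub>1 + ((\<mu> - r / t) powr \<alpha> - \<mu> powr \<alpha>))) powr (\<beta>\<^sub>1 * t)" for r t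
  have L_lim: "(L r \<longlongrightarrow> exp (r * c)) at_top" if "r \<noteq> 0" for r
    unfolding L_def c_def using assms that by (intro tempered_mittag_leffler_exponent_tendsto)
  have L_bound: "eventually (\<lambda>t. (\<integral>\<^sup>+\<omega>. ennreal (exp (r * (Z t \<omega> / t))) \<partial>P) \<le> ennreal (L r t)) at_top"
    if r: "r \<noteq> 0" for r
    \<comment> \<open>The condition \<open>t \<ge> r / \<mu>\<close> ensures
      \<open>r / t \<le> \<mu>\<close>, as the moment bound requires.\<close>
    using tempered_mittag_leffler_exponent_tendsto(1)[OF assms(5,4) r, of \<alpha>]
      eventually_gt_at_top[of 0] eventually_ge_at_top[of "r / \<mu>"]
  proof eventually_elim
    case (elim t)
    have "r / t \<le> \<mu>" using elim assms(4) by (simp add: field_simps)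
    from P.tempered_mittag_leffler_exp_moment_le[OF Z assms(5,6) elim(2) this elim(1)]
    show ?case unfolding L_def by simp
  qed
  have "((\<lambda>t. P.expectation (\<lambda>\<omega>. (Z t \<omega> / t) powr q)) \<longlongrightarrow> c powr q) at_top"
  proof (rule P.tendsto_expectation_powr[where a = "L 1" and b = "L (- 1)"])
    show "eventually (\<lambda>t. P.random_variable borel (\<lambda>\<omega>. Z t \<omega> / t)) at_top"
      using eventually_ge_at_top[of 0]
      by eventually_elim (use P.tempered_mittag_leffler_measurable[OF Z] in auto)
    show "eventually (\<lambda>t. \<forall>\<omega>\<in>space P. 0 \<le> Z t \<omega> / t) at_top"
      using eventually_ge_at_top[of 0]
      by eventually_elim (use P.tempered_mittag_leffler_nonneg[OF Z] in auto)
  qed (use c assms(8) L_lim[of 1] L_lim[of "- 1"] L_bound[of 1] L_bound[of "- 1"] in auto)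
  \<comment> \<open>A limit becomes an asymptotic equivalence because \<open>c powr q\<close> is
    nonzero; multiplying by \<open>t powr q\<close> then undoes the scaling.\<close>
  then have "(\<lambda>t. P.expectation (\<lambda>\<omega>. (Z t \<omega> / t) powr q)) \<sim>[at_top] (\<lambda>_. c powr q)"
    using c by (intro tendsto_imp_asymp_equiv_const) auto
  then have "(\<lambda>t. P.expectation (\<lambda>\<omega>. (Z t \<omega> / t) powr q) * t powr q) \<sim>[at_top] (\<lambda>t. c powr q * t powr q)"
    by (intro asymp_equiv_intros)
  moreover have "eventually (\<lambda>t. P.expectation (\<lambda>\<omega>. (Z t \<omega> / t) powr q) * t powr q =
      P.expectation (\<lambda>\<omega>. Z t \<omega> powr q)) at_top"
    using eventually_gt_at_top[of 0]
  proof eventually_elim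
    case (elim t)
    have "P.expectation (\<lambda>\<omega>. (Z t \<omega> / t) powr q) = P.expectation (\<lambda>\<omega>. Z t \<omega> powr q / t powr q)"
      using elim P.tempered_mittag_leffler_nonneg[OF Z]
      by (intro Bochner_Integration.integral_cong) (auto simp: powr_divide)
    then show ?case using elim by simp
  qed
  ultimately show ?thesis
    unfolding c_def by (rule asymp_equiv_transfer) simp
qed

end
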